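(* Suppose $G$ is a topological group acting on a set $X$. Define $\mathcal{U}:=\{U\cdot x: U\subseteq G \text{ open},\ x\in X\}$, where $U\cdot x=\{ux:u\in U\}$. Then: (1) The family $\mathcal{U}$ is a basis of a topology on $X$. Denote this topology by $\tau$. (2) The action of $G$ on $(X,\tau)$ is continuous. (3) All $G$-orbits in $X$ are clopen in $\tau$; moreover, for every $x\in X$, $G/G_x$ is homeomorphic to $G\cdot x$ (where the orbit $G\cdot x$ is equipped with the topology induced by $\tau$). (4) The following are equivalent: for all $x\in X$, $G_x$ is closed in $G$; $\tau$ is $T_1$; $\tau$ is Hausdorff.
   Context: A topological group is a group with a topology for which multiplication and inversion are continuous; it is not assumed to be Hausdorff. $G_x$ is the stabilizer of $x$ in $G$, and $G/G_x$ is the space of left cosets with the quotient topology. Continuity of the action means joint continuity of $G\times X\to X$. *)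

theory Defs
  imports "HOL-Analysis.Analysis" "HOL-Algebra.Group_Action" "HOL-Algebra.Left_Coset"
begin

text \<open>
  The topology \<open>T\<close> lives on the carrier of \<open>G\<close>; no separation axiom is assumed.
\<close>

locale topological_group = group G for G (structure) +
  fixes T :: "'a topology"
  assumes topspace_eq_carrier: "topspace T = carrier G"
    and continuous_mult: "continuous_map (prod_topology T T) T (\<lambda>(g, h). g \<otimes> h)"
    and continuous_inv: "continuous_map T T (\<lambda>g. inv g)"

definition quotient_topology :: "'a topology \<Rightarrow> ('a \<Rightarrow> 'b) \<Rightarrow> 'b topology" where
  "quotient_topology X f =
     topology (\<lambda>V. V \<subseteq> f ` topspace X \<and> openin X {x \<in> topspace X. f x \<in> V})"

lemma openin_quotient_topology:
  "openin (quotient_topology X f) V \<longleftrightarrow>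
     V \<subseteq> f ` topspace X \<and> openin X {x \<in> topspace X. f x \<in> V}"
proof -
  have "istopology (\<lambda>V. V \<subseteq> f ` topspace X \<and> openin X {x \<in> topspace X. f x \<in> V})"
    unfolding istopology_def
  proof (intro conjI allI impI)
    fix S U
    assume S: "S \<subseteq> f ` topspace X \<and> openin X {x \<in> topspace X. f x \<in> S}"
      and U: "U \<subseteq> f ` topspace X \<and> openin X {x \<in> topspace X. f x \<in> U}"
    show "S \<inter> U \<subseteq> f ` topspace X" using S by blast
    have "{x \<in> topspace X. f x \<in> S \<inter> U} =
        {x \<in> topspace X. f x \<in> S} \<inter> {x \<in> topspace X. f x \<in> U}" by blast
    then show "openin X {x \<in> topspace X. f x \<in> S \<inter> U}"
      using S U by (simp only: openin_Int)
  next
    fix K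
    assume K: "\<forall>V\<in>K. V \<subseteq> f ` topspace X \<and> openin X {x \<in> topspace X. f x \<in> V}"
    show "\<Union>K \<subseteq> f ` topspace X" using K by blast
    have "{x \<in> topspace X. f x \<in> \<Union>K} = (\<Union>V\<in>K. {x \<in> topspace X. f x \<in> V})" by blast
    moreover have "openin X (\<Union>V\<in>K. {x \<in> topspace X. f x \<in> V})"
      using K by (intro openin_Union) blast
    ultimately show "openin X {x \<in> topspace X. f x \<in> \<Union>K}" by (simp only:)
  qed
  then show ?thesis
    by (simp add: quotient_topology_def topology_inverse')
qed

lemma topspace_quotient_topology: "topspace (quotient_topology X f) = f ` topspace X"
proof
  show "topspace (quotient_topology X f) \<subseteq> f ` topspace X"
    using openin_quotient_topology[of X f "topspace (quotient_topology X f)"] by simp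
  have "{x \<in> topspace X. f x \<in> f ` topspace X} = topspace X" by blast
  then have "openin (quotient_topology X f) (f ` topspace X)"
    by (simp add: openin_quotient_topology)
  then show "f ` topspace X \<subseteq> topspace (quotient_topology X f)"
    by (rule openin_subset)
qed

lemma quotient_map_quotient_topology: "quotient_map X (quotient_topology X f) f"
  by (auto simp: quotient_map_def topspace_quotient_topology openin_quotient_topology)

definition left_coset_space ::
    "('a, 'm) monoid_scheme \<Rightarrow> 'a topology \<Rightarrow> 'a set \<Rightarrow> 'a set topology" where
  "left_coset_space G T H = quotient_topology T (\<lambda>g. g <#\<^bsub>G\<^esub> H)"

lemma (in topological_group) topspace_left_coset_space:
  "topspace (left_coset_space G T H) = lcosets H"
  by (auto simp: left_coset_space_def topspace_quotient_topology topspace_eq_carrier LCOSETS_def)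

definition action_basis :: "'a topology \<Rightarrow> 'b set \<Rightarrow> ('a \<Rightarrow> 'b \<Rightarrow> 'b) \<Rightarrow> 'b set set" where
  "action_basis T X \<phi> = {(\<lambda>u. \<phi> u x) ` U |U x. openin T U \<and> x \<in> X}"

text \<open>
  The operator \<open>topology\<close> is unspecified on predicates that are not closed under unions and
  finite intersections, so that \<open>action_basis\<close> is a basis of this topology is not part of the
  definition.
\<close>

definition action_topology :: "'a topology \<Rightarrow> 'b set \<Rightarrow> ('a \<Rightarrow> 'b \<Rightarrow> 'b) \<Rightarrow> 'b topology" where
  "action_topology T X \<phi> = topology (arbitrary union_of (\<lambda>V. V \<in> action_basis T X \<phi>))"

end

theory Submission
  imports Defs
begin

text \<open>
  The proof rests on a second description of the action topology: a set \<open>V \<subseteq> X\<close> is a union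
  of sets \<open>U \<cdot> x\<close> with \<open>U\<close> open if and only if, for each point \<open>x\<close>, the set of all \<open>g\<close> with
  \<open>g \<cdot> x \<in> V\<close> is open in the group (lemma \<open>union_of_action_basis_iff\<close>). In other words \<open>\<tau>\<close> is
  the finest topology on \<open>X\<close> for which all orbit maps \<open>g \<mapsto> g \<cdot> x\<close> are continuous. Preimages
  commute with intersections, so the unions of basic sets form a topology.

  With this description orbit maps are continuous, and with the original one they are open.
  Everything else follows from these two facts. Openness carries a neighbourhood
  of \<open>\<one>\<close> in the group to a neighbourhood of \<open>x\<close>, which reduces continuity of the action at
  \<open>(g, x)\<close> to continuity of multiplication at \<open>(g, \<one>)\<close>. The orbit map of \<open>x\<close> is
  a quotient map onto the orbit whose fibres are the left cosets of the stabilizer, so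
  the orbit is homeomorphic to the coset space. If points are closed then so is the stabilizer,
  being the preimage of a point under an orbit map. Conversely, points in distinct orbits are
  separated by the orbits, and distinct points \<open>x\<close> and \<open>g \<cdot> x\<close> are separated by images of
  neighbourhoods of \<open>\<one>\<close> and \<open>g\<close> on which \<open>a\<inverse>b\<close> avoids the closed stabilizer.
\<close>


section \<open>Actions of topological groups\<close>

locale topological_group_action = topological_group G T + group_action G X \<phi>
  for G (structure) and T and X :: "'b set" and \<phi>
begin

abbreviation \<tau> :: "'b topology" where
  "\<tau> \<equiv> action_topology T X \<phi>"

lemma carrier_if_openin: "openin T U \<Longrightarrow> u \<in> U \<Longrightarrow> u \<in> carrier G"
  using openin_subset topspace_eq_carrier by blast

lemma action_closed: "g \<in> carrier G \<Longrightarrow> x \<in> X \<Longrightarrow> \<phi> g x \<in> X"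
  using element_image by blast

lemma action_one: "x \<in> X \<Longrightarrow> \<phi> \<one> x = x"
  using id_eq_one by (metis restrict_apply')

lemma action_eq_iff_stabilizer:
  assumes "x \<in> X" "g \<in> carrier G" "h \<in> carrier G"
  shows "\<phi> g x = \<phi> h x \<longleftrightarrow> inv g \<otimes> h \<in> stabilizer G \<phi> x"
proof
  assume "\<phi> g x = \<phi> h x"
  then have "\<phi> (inv g \<otimes> h) x = x"
    using assms orbit_sym_aux by (simp add: composition_rule)
  then show "inv g \<otimes> h \<in> stabilizer G \<phi> x"
    using assms by (simp add: stabilizer_def)
next
  assume "inv g \<otimes> h \<in> stabilizer G \<phi> x"
  then have "\<phi> g x = \<phi> g (\<phi> (inv g \<otimes> h) x)"
    by (simp add: stabilizer_def)
  also have "\<dots> = \<phi> (g \<otimes> (inv g \<otimes> h)) x"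
    using assms composition_rule[of x g "inv g \<otimes> h"] by simp
  also have "g \<otimes> (inv g \<otimes> h) = h"
    using assms by (simp add: m_assoc[symmetric])
  finally show "\<phi> g x = \<phi> h x" .
qed

lemma l_coset_stabilizer_eq_iff:
  assumes "x \<in> X" "g \<in> carrier G" "h \<in> carrier G"
  shows "g <#\<^bsub>G\<^esub> stabilizer G \<phi> x = h <#\<^bsub>G\<^esub> stabilizer G \<phi> x \<longleftrightarrow> \<phi> g x = \<phi> h x"
proof
  assume "g <#\<^bsub>G\<^esub> stabilizer G \<phi> x = h <#\<^bsub>G\<^esub> stabilizer G \<phi> x"
  then have "h \<in> g <#\<^bsub>G\<^esub> stabilizer G \<phi> x"
    using assms lcos_self stabilizer_subgroup by blast
  then show "\<phi> g x = \<phi> h x"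
    using assms by (auto simp: l_coset_def stabilizer_def composition_rule)
next
  assume "\<phi> g x = \<phi> h x"
  then have "inv g \<otimes> h \<in> stabilizer G \<phi> x"
    using assms action_eq_iff_stabilizer by blast
  moreover have "h = g \<otimes> (inv g \<otimes> h)"
    using assms by (simp add: m_assoc[symmetric])
  ultimately have "h \<in> g <#\<^bsub>G\<^esub> stabilizer G \<phi> x"
    unfolding l_coset_def by blast
  then show "g <#\<^bsub>G\<^esub> stabilizer G \<phi> x = h <#\<^bsub>G\<^esub> stabilizer G \<phi> x"
    using assms l_repr_independence stabilizer_subgroup by blast
qed

lemma openin_mult_nhds:
  assumes "openin T W" "g \<in> carrier G" "h \<in> carrier G" "g \<otimes> h \<in> W"
  obtains U V where "openin T U" "openin T V" "g \<in> U" "h \<in> V"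
    "\<And>u v. u \<in> U \<Longrightarrow> v \<in> V \<Longrightarrow> u \<otimes> v \<in> W"
proof -
  let ?P = "{p \<in> topspace (prod_topology T T). (\<lambda>(g, h). g \<otimes> h) p \<in> W}"
  have P: "openin (prod_topology T T) ?P"
    using continuous_mult assms(1) by (rule openin_continuous_map_preimage)
  have "(g, h) \<in> ?P"
    using assms by (simp add: topspace_eq_carrier)
  from openin_prod_topology_alt[THEN iffD1, rule_format, OF P this]
  obtain U V where UV: "openin T U" "openin T V" "g \<in> U" "h \<in> V" "U \<times> V \<subseteq> ?P"
    by (elim exE conjE)
  from UV(5) have "u \<otimes> v \<in> W" if "u \<in> U" "v \<in> V" for u v
    using that by fastforce
  then show thesis
    using UV that by blast
qed


section \<open>The action topology\<close>

text \<open>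
  If \<open>g \<cdot> y = u \<cdot> x\<close> with \<open>u \<in> U\<close>, then \<open>y = (g\<inverse>u) \<cdot> x\<close>, so the translate of \<open>U\<close> consisting of
  all \<open>w\<close> with \<open>w g\<inverse>u \<in> U\<close> is a neighbourhood of \<open>g\<close> that moves \<open>y\<close> into \<open>U \<cdot> x\<close>.
\<close>

lemma openin_orbit_preimage_basis:
  assumes "V \<in> action_basis T X \<phi>" and y: "y \<in> X"
  shows "openin T {g \<in> carrier G. \<phi> g y \<in> V}"
  unfolding openin_subopen[of T "{g \<in> carrier G. \<phi> g y \<in> V}"]
proof
  obtain U x where U: "openin T U" and x: "x \<in> X" and V: "V = (\<lambda>u. \<phi> u x) ` U"
    using assms(1) unfolding action_basis_def by blast
  fix g assume "g \<in> {g \<in> carrier G. \<phi> g y \<in> V}"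
  then obtain u where g: "g \<in> carrier G" and u: "u \<in> U" "\<phi> g y = \<phi> u x"
    unfolding V by blast
  have uG: "u \<in> carrier G"
    using U u(1) carrier_if_openin by blast
  define k where "k = inv g \<otimes> u"
  have k: "k \<in> carrier G"
    using g uG by (simp add: k_def)
  have "y = \<phi> (inv g) (\<phi> u x)"
    using orbit_sym_aux[OF g y u(2)] by simp
  then have yk: "y = \<phi> k x"
    using g uG x by (simp add: k_def composition_rule)
  have "g \<otimes> k \<in> U"
    using g uG u(1) by (simp add: k_def m_assoc[symmetric])
  then obtain A B where AB: "openin T A" "g \<in> A" "k \<in> B" "\<And>a b. a \<in> A \<Longrightarrow> b \<in> B \<Longrightarrow> a \<otimes> b \<in> U"
    using openin_mult_nhds[OF U g k] by metis
  have "\<phi> a y \<in> V" if "a \<in> A" for a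
  proof -
    have "\<phi> a y = \<phi> (a \<otimes> k) x"
      using AB(1) that k x yk carrier_if_openin by (simp add: composition_rule)
    then show ?thesis
      using AB(3,4) that unfolding V by blast
  qed
  then show "\<exists>A. openin T A \<and> g \<in> A \<and> A \<subseteq> {g \<in> carrier G. \<phi> g y \<in> V}"
    using AB(1,2) carrier_if_openin by blast
qed

text \<open>
  The converse direction holds because \<open>V\<close> is the union, over \<open>v \<in> V\<close>, of the sets \<open>U \<cdot> v\<close> in which
  \<open>U\<close> is the preimage of \<open>V\<close> under the orbit map of \<open>v\<close>.
\<close>

lemma union_of_action_basis_iff:
  "(arbitrary union_of (\<lambda>V. V \<in> action_basis T X \<phi>)) V \<longleftrightarrow>
     V \<subseteq> X \<and> (\<forall>x\<in>X. openin T {g \<in> carrier G. \<phi> g x \<in> V})"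
proof
  assume "(arbitrary union_of (\<lambda>V. V \<in> action_basis T X \<phi>)) V"
  then obtain \<B> where \<B>: "\<B> \<subseteq> action_basis T X \<phi>" "V = \<Union>\<B>"
    unfolding union_of_def arbitrary_def by blast
  have "B \<subseteq> X" if "B \<in> \<B>" for B
    using that \<B>(1) carrier_if_openin action_closed unfolding action_basis_def by blast
  moreover have "openin T {g \<in> carrier G. \<phi> g x \<in> V}" if "x \<in> X" for x
  proof -
    have "{g \<in> carrier G. \<phi> g x \<in> V} = (\<Union>B\<in>\<B>. {g \<in> carrier G. \<phi> g x \<in> B})"
      using \<B>(2) by blast
    moreover have "openin T (\<Union>B\<in>\<B>. {g \<in> carrier G. \<phi> g x \<in> B})"
      using \<B>(1) that openin_orbit_preimage_basis by (intro openin_Union) blast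
    ultimately show ?thesis
      by simp
  qed
  ultimately show "V \<subseteq> X \<and> (\<forall>x\<in>X. openin T {g \<in> carrier G. \<phi> g x \<in> V})"
    using \<B>(2) by blast
next
  assume V: "V \<subseteq> X \<and> (\<forall>x\<in>X. openin T {g \<in> carrier G. \<phi> g x \<in> V})"
  let ?B = "\<lambda>v. (\<lambda>g. \<phi> g v) ` {g \<in> carrier G. \<phi> g v \<in> V}"
  have "v \<in> ?B v" if "v \<in> V" for v
    using that V action_one[of v] one_closed by (metis (mono_tags, lifting) imageI mem_Collect_eq subsetD)
  then have "V = (\<Union>v\<in>V. ?B v)"
    by blast
  moreover have "?B ` V \<subseteq> action_basis T X \<phi>"
    using V unfolding action_basis_def by blast
  ultimately show "(arbitrary union_of (\<lambda>V. V \<in> action_basis T X \<phi>)) V"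
    unfolding union_of_def arbitrary_def by (intro exI[of _ "?B ` V"]) blast
qed

lemma openin_action_topology:
  "openin \<tau> = arbitrary union_of (\<lambda>V. V \<in> action_basis T X \<phi>)"
proof -
  have "istopology (arbitrary union_of (\<lambda>V. V \<in> action_basis T X \<phi>))"
    unfolding istopology_base_alt union_of_action_basis_iff
  proof (intro allI impI conjI ballI)
    fix V W x
    assume VW: "(V \<subseteq> X \<and> (\<forall>x\<in>X. openin T {g \<in> carrier G. \<phi> g x \<in> V})) \<and>
      W \<subseteq> X \<and> (\<forall>x\<in>X. openin T {g \<in> carrier G. \<phi> g x \<in> W})"
    then show "V \<inter> W \<subseteq> X"
      by blast
    assume "x \<in> X"
    then have "openin T ({g \<in> carrier G. \<phi> g x \<in> V} \<inter> {g \<in> carrier G. \<phi> g x \<in> W})"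
      using VW by blast
    moreover have "{g \<in> carrier G. \<phi> g x \<in> V \<inter> W} =
        {g \<in> carrier G. \<phi> g x \<in> V} \<inter> {g \<in> carrier G. \<phi> g x \<in> W}"
      by blast
    ultimately show "openin T {g \<in> carrier G. \<phi> g x \<in> V \<inter> W}"
      by simp
  qed
  then show ?thesis
    by (simp add: action_topology_def topology_inverse')
qed

lemma openin_action_topology_iff:
  "openin \<tau> V \<longleftrightarrow> V \<subseteq> X \<and> (\<forall>x\<in>X. openin T {g \<in> carrier G. \<phi> g x \<in> V})"
  by (simp add: openin_action_topology union_of_action_basis_iff)

lemma topspace_action_topology: "topspace \<tau> = X"
proof
  show "topspace \<tau> \<subseteq> X"
    using openin_action_topology_iff openin_topspace by blast
  have "{g \<in> carrier G. \<phi> g x \<in> X} = topspace T" if "x \<in> X" for x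
    using that action_closed by (auto simp: topspace_eq_carrier)
  then have "openin \<tau> X"
    by (simp add: openin_action_topology_iff)
  then show "X \<subseteq> topspace \<tau>"
    by (rule openin_subset)
qed

lemma continuous_map_orbit_map:
  assumes "x \<in> X"
  shows "continuous_map T \<tau> (\<lambda>g. \<phi> g x)"
  using assms action_closed
  by (auto simp: continuous_map_def topspace_action_topology topspace_eq_carrier
      openin_action_topology_iff)

lemma open_map_orbit_map:
  assumes "x \<in> X"
  shows "open_map T \<tau> (\<lambda>g. \<phi> g x)"
  unfolding open_map_def openin_action_topology action_basis_def
  using assms by (blast intro: union_of_inc[unfolded o_def] arbitrary_union_of_inc)

lemma continuous_map_action:
  "continuous_map (prod_topology T \<tau>) \<tau> (\<lambda>(g, x). \<phi> g x)"
  unfolding continuous_map_def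
proof (intro conjI allI impI)
  show "(\<lambda>(g, x). \<phi> g x) \<in> topspace (prod_topology T \<tau>) \<rightarrow> topspace \<tau>"
    using action_closed by (auto simp: topspace_action_topology topspace_eq_carrier)
next
  fix V assume V: "openin \<tau> V"
  let ?P = "{p \<in> topspace (prod_topology T \<tau>). (case p of (g, x) \<Rightarrow> \<phi> g x) \<in> V}"
  show "openin (prod_topology T \<tau>) ?P"
    unfolding openin_prod_topology_alt
  proof (intro allI impI)
    fix g x assume "(g, x) \<in> ?P"
    then have g: "g \<in> carrier G" and x: "x \<in> X" and gx: "\<phi> g x \<in> V"
      by (auto simp: topspace_action_topology topspace_eq_carrier)
    have O: "openin T {h \<in> carrier G. \<phi> h x \<in> V}"
      using V x openin_action_topology_iff by blast
    have "g \<otimes> \<one> \<in> {h \<in> carrier G. \<phi> h x \<in> V}"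
      using g gx by simp
    from openin_mult_nhds[OF O g one_closed this] obtain A B where AB: "openin T A" "openin T B" "g \<in> A" "\<one> \<in> B"
      "\<And>a b. a \<in> A \<Longrightarrow> b \<in> B \<Longrightarrow> a \<otimes> b \<in> {h \<in> carrier G. \<phi> h x \<in> V}"
      by blast
    let ?W = "(\<lambda>b. \<phi> b x) ` B"
    have W: "openin \<tau> ?W"
      using open_map_orbit_map[OF x] AB(2) unfolding open_map_def by blast
    moreover have "x \<in> ?W"
      using AB(4) action_one[OF x] by (metis imageI)
    moreover have "A \<times> ?W \<subseteq> ?P"
    proof clarify
      fix a b assume ab: "a \<in> A" "b \<in> B"
      then have "a \<in> carrier G" "b \<in> carrier G"
        using AB(1,2) carrier_if_openin by blast+
      then have "\<phi> a (\<phi> b x) \<in> V"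
        using AB(5)[OF ab] x by (simp add: composition_rule)
      then show "(a, \<phi> b x) \<in> topspace (prod_topology T \<tau>) \<and> \<phi> a (\<phi> b x) \<in> V"
        using \<open>a \<in> carrier G\<close> \<open>b \<in> carrier G\<close> x action_closed
        by (simp add: topspace_action_topology topspace_eq_carrier)
    qed
    ultimately show "\<exists>A W. openin T A \<and> openin \<tau> W \<and> g \<in> A \<and> x \<in> W \<and> A \<times> W \<subseteq> ?P"
      using AB(1,3) by blast
  qed
qed


section \<open>Orbits\<close>

lemma orbit_eq_image: "orbit G \<phi> x = (\<lambda>g. \<phi> g x) ` carrier G"
  unfolding orbit_def by blast

lemma orbit_subset: "x \<in> X \<Longrightarrow> orbit G \<phi> x \<subseteq> X"
  unfolding orbit_eq_image using action_closed by blast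

lemma openin_orbit:
  assumes "x \<in> X"
  shows "openin \<tau> (orbit G \<phi> x)"
  using open_map_orbit_map[OF assms] openin_topspace[of T]
  unfolding open_map_def orbit_eq_image topspace_eq_carrier by blast

text \<open>The orbits partition \<open>X\<close> into open sets, so each of them is also closed.\<close>

lemma closedin_orbit:
  assumes "A \<in> orbits G X \<phi>"
  shows "closedin \<tau> A"
proof -
  have "X - A = \<Union>(orbits G X \<phi> - {A})"
    using disjoint_union[OF assms] orbits_coverture by blast
  moreover have "openin \<tau> (\<Union>(orbits G X \<phi> - {A}))"
    using openin_orbit unfolding orbits_def by (intro openin_Union) blast
  moreover have "A \<subseteq> X"
    using assms orbits_coverture by blast
  ultimately show ?thesis
    by (simp add: closedin_def topspace_action_topology)
qed

text \<open>
  The orbit map of \<open>x\<close> and the projection to left cosets are quotient maps from the group with the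
  same fibres, so each one factors through the other.
\<close>

lemma left_coset_space_homeomorphic_orbit:
  assumes x: "x \<in> X"
  shows "left_coset_space G T (stabilizer G \<phi> x)
    homeomorphic_space subtopology \<tau> (orbit G \<phi> x)"
proof -
  let ?H = "stabilizer G \<phi> x" and ?O = "subtopology \<tau> (orbit G \<phi> x)"
  let ?p = "\<lambda>g. g <#\<^bsub>G\<^esub> ?H" and ?f = "\<lambda>g. \<phi> g x"
  have f: "quotient_map T ?O ?f"
  proof (rule continuous_open_imp_quotient_map)
    show "continuous_map T ?O ?f"
      using continuous_map_orbit_map[OF x]
      by (rule continuous_map_into_subtopology) (auto simp: orbit_eq_image topspace_eq_carrier)
    show "open_map T ?O ?f"
      using open_map_orbit_map[OF x]
      by (rule open_map_into_subtopology) (auto simp: orbit_eq_image topspace_eq_carrier)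
    show "?f ` topspace T = topspace ?O"
      using orbit_subset[OF x]
      by (auto simp: topspace_action_topology topspace_eq_carrier orbit_eq_image)
  qed
  have p: "quotient_map T (left_coset_space G T ?H) ?p"
    unfolding left_coset_space_def by (rule quotient_map_quotient_topology)
  have fibres: "?p g = ?p h \<longleftrightarrow> ?f g = ?f h" if "g \<in> topspace T" "h \<in> topspace T" for g h
    using that x l_coset_stabilizer_eq_iff by (simp add: topspace_eq_carrier)
  obtain F where F: "\<And>g. g \<in> topspace T \<Longrightarrow> F (?p g) = ?f g"
    using quotient_map_lift_exists[OF p quotient_imp_continuous_map[OF f]] fibres by metis
  have "quotient_map T ?O (F \<circ> ?p)"
    using f by (rule quotient_map_eq) (simp add: F)
  then have "quotient_map (left_coset_space G T ?H) ?O F"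
    using p quotient_map_compose_eq by blast
  moreover have "inj_on F (topspace (left_coset_space G T ?H))"
    unfolding quotient_imp_surjective_map[OF p, symmetric]
    using F fibres by (auto simp: inj_on_def)
  ultimately show ?thesis
    using homeomorphic_map_def homeomorphic_map_imp_homeomorphic_space by blast
qed


section \<open>Separation\<close>

lemma closedin_stabilizer_if_t1:
  assumes "t1_space \<tau>" "x \<in> X"
  shows "closedin T (stabilizer G \<phi> x)"
proof -
  have "closedin \<tau> {x}"
    using assms by (simp add: t1_space_closedin_singleton topspace_action_topology)
  then have "closedin T {g \<in> topspace T. \<phi> g x \<in> {x}}"
    using continuous_map_orbit_map[OF assms(2)] closedin_continuous_map_preimage by blast
  then show ?thesis
    by (simp add: stabilizer_def topspace_eq_carrier)
qed

text \<open>
  The points \<open>a \<cdot> x\<close> and \<open>b \<cdot> x\<close> differ exactly when \<open>a\<inverse>b\<close> lies outside the stabilizer of \<open>x\<close>, which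
  is an open condition on the pair \<open>(a, b)\<close>.
\<close>

lemma separate_within_orbit:
  assumes x: "x \<in> X" and closed: "closedin T (stabilizer G \<phi> x)"
    and g: "g \<in> carrier G" and neq: "\<phi> g x \<noteq> x"
  shows "\<exists>V W. openin \<tau> V \<and> openin \<tau> W \<and> x \<in> V \<and> \<phi> g x \<in> W \<and> disjnt V W"
proof -
  let ?H = "stabilizer G \<phi> x"
  let ?N = "carrier G - ?H"
  have N: "openin T ?N"
    using closed by (simp add: closedin_def topspace_eq_carrier)
  \<comment> \<open>The unreduced \<open>inv \<one>\<close> makes \<open>A\<close> a neighbourhood whose preimage under inversion contains \<open>\<one>\<close>.\<close>
  have "inv \<one> \<otimes> g \<in> ?N"
    using g neq by (simp add: stabilizer_def)
  from openin_mult_nhds[OF N inv_closed[OF one_closed] g this]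
  obtain A B where AB: "openin T A" "openin T B" "inv \<one> \<in> A" "g \<in> B"
    "\<And>a b. a \<in> A \<Longrightarrow> b \<in> B \<Longrightarrow> a \<otimes> b \<in> ?N"
    by blast
  define A' where "A' = {a \<in> carrier G. inv a \<in> A}"
  have A': "openin T A'"
    using openin_continuous_map_preimage[OF continuous_inv AB(1)]
    by (simp add: A'_def topspace_eq_carrier)
  let ?V = "(\<lambda>a. \<phi> a x) ` A'" and ?W = "(\<lambda>b. \<phi> b x) ` B"
  have "openin \<tau> ?V" "openin \<tau> ?W"
    using open_map_orbit_map[OF x] A' AB(2) unfolding open_map_def by blast+
  moreover have "\<one> \<in> A'"
    using AB(3) by (simp add: A'_def)
  then have "x \<in> ?V"
    using action_one[OF x] by (metis imageI)
  moreover have "\<phi> g x \<in> ?W"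
    using AB(4) by blast
  moreover have "\<phi> a x \<noteq> \<phi> b x" if "a \<in> A'" "b \<in> B" for a b
  proof -
    have "a \<in> carrier G" "b \<in> carrier G"
      using that AB(2) carrier_if_openin by (auto simp: A'_def)
    moreover have "inv a \<otimes> b \<notin> ?H"
      using that AB(5) by (auto simp: A'_def)
    ultimately show ?thesis
      using x action_eq_iff_stabilizer by blast
  qed
  then have "disjnt ?V ?W"
    unfolding disjnt_iff by blast
  ultimately show ?thesis
    by blast
qed

lemma Hausdorff_if_closedin_stabilizers:
  assumes closed: "\<And>x. x \<in> X \<Longrightarrow> closedin T (stabilizer G \<phi> x)"
  shows "Hausdorff_space \<tau>"
  unfolding Hausdorff_space_def topspace_action_topology
proof (intro allI impI, elim conjE)
  fix x y assume x: "x \<in> X" and y: "y \<in> X" and neq: "x \<noteq> y"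
  show "\<exists>V W. openin \<tau> V \<and> openin \<tau> W \<and> x \<in> V \<and> y \<in> W \<and> disjnt V W"
  proof (cases "y \<in> orbit G \<phi> x")
    case True
    then obtain g where "g \<in> carrier G" "y = \<phi> g x"
      unfolding orbit_def by blast
    then show ?thesis
      using separate_within_orbit[OF x closed[OF x]] neq by metis
  next
    case False
    have "orbit G \<phi> x \<in> orbits G X \<phi>" "orbit G \<phi> y \<in> orbits G X \<phi>"
      using x y unfolding orbits_def by blast+
    then have "disjnt (orbit G \<phi> x) (orbit G \<phi> y)"
      using disjoint_union False orbit_refl[OF y] unfolding disjnt_def by blast
    then show ?thesis
      using openin_orbit x y orbit_refl by blast
  qed
qed

end

theorem mainTheorem4:
  fixes G :: "('a, 'm) monoid_scheme" and T :: "'a topology"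
    and X :: "'b set" and \<phi> :: "'a \<Rightarrow> 'b \<Rightarrow> 'b"
  assumes "topological_group G T"
    and "group_action G X \<phi>"
  defines "\<tau> \<equiv> action_topology T X \<phi>"
  shows
    "(topspace \<tau> = X \<and> openin \<tau> = arbitrary union_of (\<lambda>V. V \<in> action_basis T X \<phi>)) \<and>
     continuous_map (prod_topology T \<tau>) \<tau> (\<lambda>(g, x). \<phi> g x) \<and>
     (\<forall>A \<in> orbits G X \<phi>. openin \<tau> A \<and> closedin \<tau> A) \<and>
     (\<forall>x \<in> X. left_coset_space G T (stabilizer G \<phi> x)
                homeomorphic_space subtopology \<tau> (orbit G \<phi> x)) \<and>
     ((\<forall>x \<in> X. closedin T (stabilizer G \<phi> x)) \<longleftrightarrow> t1_space \<tau>) \<and>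
     (t1_space \<tau> \<longleftrightarrow> Hausdorff_space \<tau>)"
proof -
  interpret topological_group_action G T X \<phi>
    using assms(1,2) by (rule topological_group_action.intro)
  have "openin \<tau> A \<and> closedin \<tau> A" if "A \<in> orbits G X \<phi>" for A
    using that openin_orbit closedin_orbit unfolding \<tau>_def orbits_def by blast
  moreover have "Hausdorff_space \<tau>" if "\<forall>x\<in>X. closedin T (stabilizer G \<phi> x)"
    using that Hausdorff_if_closedin_stabilizers unfolding \<tau>_def by blast
  moreover have "\<forall>x\<in>X. closedin T (stabilizer G \<phi> x)" if "t1_space \<tau>"
    using that closedin_stabilizer_if_t1 unfolding \<tau>_def by blast
  moreover have "t1_space \<tau>" if "Hausdorff_space \<tau>"
    using that by (rule Hausdorff_imp_t1_space)
  ultimately show ?thesis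
    using topspace_action_topology openin_action_topology continuous_map_action
      left_coset_space_homeomorphic_orbit
    unfolding \<tau>_def by blast
qed

end
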